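(* Let $\lambda<0$ and $\theta_1\in(0,\pi/4)$. Then there is no function $u$ with $u(0)\in(0,1)$ that solves $$u''(\theta)+2\,\frac{\cos(2\theta)}{\sin(2\theta)}\,u'(\theta)=\lambda\,\bigl(u(\theta)^5-u(\theta)\bigr),\quad u>0\ \text{ on }(0,\theta_1),\qquad u'(0)=0,\qquad u(\theta_1)=0.$$
   Context: Solutions are understood in the classical sense on $[0,\theta_1]$. *)

theory Defs
  imports Complex_Main
begin

(* u is of class C^2 on S with first and second derivatives u' and u''. Derivatives are taken
   within S, so at an endpoint of a closed interval they are one-sided; on a nondegenerate
   interval u' and u'' are determined on S by u. *)
definition C2_on :: "real set \<Rightarrow> (real \<Rightarrow> real) \<Rightarrow> (real \<Rightarrow> real) \<Rightarrow> (real \<Rightarrow> real) \<Rightarrow> bool" where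
  "C2_on S u u' u'' \<longleftrightarrow>
     (\<forall>\<theta>\<in>S. (u has_real_derivative u' \<theta>) (at \<theta> within S)) \<and>
     (\<forall>\<theta>\<in>S. (u' has_real_derivative u'' \<theta>) (at \<theta> within S)) \<and>
     continuous_on S u''"

end

(* The energy u'^2/2 - l (u^6/6 - u^2/2) is nonincreasing because cot (2 \<theta>) > 0 for \<theta> < pi/4.
   It is negative at 0, where u' = 0 and 0 < u < 1, but nonnegative wherever u vanishes. *)
theory Submission
  imports Defs
begin

text \<open>Read the equation as motion of a particle in the potential
  \<open>- l * (u ^ 6 / 6 - u ^ 2 / 2)\<close> with friction coefficient 2 cot(2x), positive before
  pi/4. For l < 0 the particle starts at rest inside a well, at negative total energy. Friction only
  removes energy (\<open>energy_nonincreasing\<close>), so it can never reach u = 0, where the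
  potential is zero.\<close>

lemma energy_nonincreasing:
  fixes u u' u'' :: "real \<Rightarrow> real"
  assumes "0 < b" and "b < pi/4"
    and C2: "C2_on {0..b} u u' u''"
    and ode: "\<And>x. 0 < x \<Longrightarrow> x < b \<Longrightarrow>
      u'' x + 2 * (cos (2 * x) / sin (2 * x)) * u' x = l * (u x ^ 5 - u x)"
  defines "E \<equiv> \<lambda>x. u' x ^ 2 / 2 - l * (u x ^ 6 / 6 - u x ^ 2 / 2)"
  shows "E b \<le> E 0"
\<comment> \<open>The equation holds only in the open interval, and cot(2x) is singular at 0; at the
  endpoints continuity of \<open>E\<close> suffices.\<close>
proof (rule DERIV_nonpos_imp_decreasing_open[where f = E])
  show "0 \<le> b" using \<open>0 < b\<close> by simp
next
  have "continuous_on {0..b} u" "continuous_on {0..b} u'"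
    using C2 unfolding C2_on_def by (auto intro: DERIV_continuous_on)
  then show "continuous_on {0..b} E"
    unfolding E_def by (intro continuous_intros) auto
next
  fix x assume x: "0 < x" "x < b"
  have deriv: "DERIV u x :> u' x" "DERIV u' x :> u'' x"
    using C2 x unfolding C2_on_def by (metis at_within_Icc_at atLeastAtMost_iff less_imp_le)+
  have "DERIV E x :> u' x * (u'' x - l * (u x ^ 5 - u x))"
    unfolding E_def
    by (rule derivative_eq_intros deriv refl | simp)+ (simp add: field_simps)
  \<comment> \<open>By the equation, only the friction term survives in the derivative of
    \<open>E\<close>.\<close>
  moreover have "u'' x - l * (u x ^ 5 - u x) = - (2 * (cos (2 * x) / sin (2 * x)) * u' x)"
    using ode[OF x] by simp
  then have "u' x * (u'' x - l * (u x ^ 5 - u x)) = - (2 * (cos (2 * x) / sin (2 * x)) * u' x ^ 2)"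
    by (simp add: power2_eq_square)
  \<comment> \<open>The bound pi/4 enters here: 2x stays in (0, pi/2).\<close>
  moreover have "cos (2 * x) > 0" "sin (2 * x) > 0"
    using x \<open>b < pi/4\<close> by (auto intro: cos_gt_zero sin_gt_zero)
  ultimately show "\<exists>y. DERIV E x :> y \<and> y \<le> 0"
    by (metis divide_nonneg_pos less_imp_le mult_nonneg_nonneg neg_le_0_iff_le
        zero_le_numeral zero_le_power2)
qed

theorem theorem1p2:
  fixes l \<theta>1 :: real
  assumes "l < 0"
    and "\<theta>1 \<in> {0<..<pi/4}"
  shows "\<nexists>u :: real \<Rightarrow> real. u 0 \<in> {0<..<1} \<and>
    (\<exists>u' u''. C2_on {0..\<theta>1} u u' u'' \<and>
      (\<forall>\<theta>\<in>{0<..<\<theta>1}.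
         u'' \<theta> + 2 * (cos (2 * \<theta>) / sin (2 * \<theta>)) * u' \<theta> = l * (u \<theta> ^ 5 - u \<theta>)) \<and>
      (\<forall>\<theta>\<in>{0<..<\<theta>1}. u \<theta> > 0) \<and>
      u' 0 = 0 \<and> u \<theta>1 = 0)"
proof (intro notI, elim exE conjE)
  fix u u' u'' :: "real \<Rightarrow> real"
  assume u0: "u 0 \<in> {0<..<1}" and C2: "C2_on {0..\<theta>1} u u' u''"
    and ode: "\<forall>\<theta>\<in>{0<..<\<theta>1}.
      u'' \<theta> + 2 * (cos (2 * \<theta>) / sin (2 * \<theta>)) * u' \<theta> = l * (u \<theta> ^ 5 - u \<theta>)"
    and bc: "u' 0 = 0" "u \<theta>1 = 0"
  have "u' \<theta>1 ^ 2 / 2 - l * (u \<theta>1 ^ 6 / 6 - u \<theta>1 ^ 2 / 2)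
      \<le> u' 0 ^ 2 / 2 - l * (u 0 ^ 6 / 6 - u 0 ^ 2 / 2)"
    using assms C2 ode by (intro energy_nonincreasing[where u'' = u'']) auto
  \<comment> \<open>The final energy is purely kinetic, the initial one purely potential.\<close>
  then have "u' \<theta>1 ^ 2 / 2 \<le> - (l * (u 0 ^ 6 / 6 - u 0 ^ 2 / 2))"
    using bc by simp
  moreover have "u 0 ^ 6 / 6 - u 0 ^ 2 / 2 < 0"
  proof -
    \<comment> \<open>This bounds the expression by \<open>- (u 0 ^ 2) / 3\<close>.\<close>
    have "u 0 ^ 6 \<le> u 0 ^ 2" using u0 by (intro power_decreasing) auto
    moreover have "0 < u 0 ^ 2" using u0 by simp
    ultimately show ?thesis by linarith
  qed
  then have "l * (u 0 ^ 6 / 6 - u 0 ^ 2 / 2) > 0"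
    using \<open>l < 0\<close> by (rule mult_neg_neg[rotated])
  moreover have "u' \<theta>1 ^ 2 \<ge> 0"
    by simp
  ultimately show False
    by linarith
qed

end
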